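(* For $n$ sufficiently large, almost all connected $100$-regular graphs of order $n$ are not $3$-good; that is, the proportion of $3$-good graphs among the connected $100$-regular graphs on vertex set $\{1,\ldots,n\}$ tends to $0$ as $n\to\infty$.
   Context: All graphs are finite and simple. The Ramsey number $r(H_1,H_2)$ is the least $n$ such that for every partition $E(K_n)=E(R)\cup E(B)$ of the edges of $K_n$ into the edge sets of two graphs $R,B$ on $V(K_n)$, either $H_1\subset R$ or $H_2\subset B$. A connected graph $H$ is $p$-good if $r(K_p,H)=(p-1)(|H|-1)+1$, where $|H|$ is the order of $H$; so $H$ is $3$-good if $r(K_3,H)=2(|H|-1)+1$. *)

theory Defs
  imports Complex_Main "HOL-Library.Ramsey"
begin

text \<open>
  A graph is a pair of a vertex set and an edge set.  Edges are 2-element sets of vertices;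
  \<open>[V]\<^bsup>2\<^esup>\<close> is the set of all 2-element subsets of \<open>V\<close> (from \<open>HOL-Library.Ramsey\<close>), so loops and
  parallel edges are impossible.
\<close>

type_synonym 'a graph = "'a set \<times> 'a set set"

abbreviation verts :: "'a graph \<Rightarrow> 'a set" where "verts G \<equiv> fst G"
abbreviation edges :: "'a graph \<Rightarrow> 'a set set" where "edges G \<equiv> snd G"

definition simple_graph :: "'a graph \<Rightarrow> bool" where
  "simple_graph G \<longleftrightarrow> finite (verts G) \<and> edges G \<subseteq> [verts G]\<^bsup>2\<^esup>"

definition connected_graph :: "'a graph \<Rightarrow> bool" where
  "connected_graph G \<longleftrightarrow> simple_graph G \<and> verts G \<noteq> {} \<and>
     (\<forall>u\<in>verts G. \<forall>v\<in>verts G. (u, v) \<in> {(x, y). {x, y} \<in> edges G}\<^sup>*)"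

definition graph_degree :: "'a graph \<Rightarrow> 'a \<Rightarrow> nat" where
  "graph_degree G v = card {e \<in> edges G. v \<in> e}"

definition regular_graph :: "nat \<Rightarrow> 'a graph \<Rightarrow> bool" where
  "regular_graph d G \<longleftrightarrow> simple_graph G \<and> (\<forall>v\<in>verts G. graph_degree G v = d)"

definition complete_graph :: "nat \<Rightarrow> nat graph" where
  "complete_graph n = ({1..n}, [{1..n}]\<^bsup>2\<^esup>)"

text \<open>
  \<open>contains_copy H G\<close> is \<open>H \<subset> G\<close> in the sense of Ramsey theory: \<open>G\<close> has a subgraph, not necessarily
  induced, that is isomorphic to \<open>H\<close>.
\<close>

definition contains_copy :: "'a graph \<Rightarrow> 'b graph \<Rightarrow> bool" where
  "contains_copy H G \<longleftrightarrow>
     (\<exists>f. inj_on f (verts H) \<and> f ` verts H \<subseteq> verts G \<and> (\<forall>e\<in>edges H. f ` e \<in> edges G))"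

definition ramsey_arrows :: "nat \<Rightarrow> 'a graph \<Rightarrow> 'b graph \<Rightarrow> bool" where
  "ramsey_arrows n H1 H2 \<longleftrightarrow>
     (\<forall>R B :: nat graph.
        verts R = {1..n} \<and> verts B = {1..n} \<and>
        edges R \<union> edges B = edges (complete_graph n) \<and> edges R \<inter> edges B = {} \<longrightarrow>
        contains_copy H1 R \<or> contains_copy H2 B)"

definition ramsey_number :: "'a graph \<Rightarrow> 'b graph \<Rightarrow> nat" where
  "ramsey_number H1 H2 = (LEAST n. ramsey_arrows n H1 H2)"

definition p_good :: "nat \<Rightarrow> 'a graph \<Rightarrow> bool" where
  "p_good p H \<longleftrightarrow> connected_graph H \<and>
     ramsey_number (complete_graph p) H = (p - 1) * (card (verts H) - 1) + 1"

text \<open>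
  By Ramsey's theorem the minimum defining \<open>ramsey_number\<close> exists, so \<open>LEAST\<close> is never applied to
  an unsatisfiable predicate.
\<close>

lemma contains_copy_if_clique:
  fixes H :: "'a graph" and K :: "nat set"
  assumes "simple_graph H" "finite K" "card K = card (verts H)"
    and "K \<subseteq> verts G" "[K]\<^bsup>2\<^esup> \<subseteq> edges G"
  shows "contains_copy H G"
proof -
  obtain f where f: "bij_betw f (verts H) K"
    using assms by (metis finite_same_card_bij simple_graph_def)
  have "f ` e \<in> edges G" if "e \<in> edges H" for e
  proof -
    have "e \<in> [verts H]\<^bsup>2\<^esup>"
      using assms(1) that by (auto simp: simple_graph_def)
    then have "f ` e \<in> [K]\<^bsup>2\<^esup>"
      using bij_betw_nsets[OF f, of 2] by (auto simp: bij_betw_def)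
    then show ?thesis using assms(5) by blast
  qed
  then show ?thesis
    using f assms(4) unfolding contains_copy_def bij_betw_def by blast
qed

lemma ramsey_arrows_ramsey_number:
  fixes H1 :: "'a graph" and H2 :: "'b graph"
  assumes "simple_graph H1" "simple_graph H2"
  shows "ramsey_arrows (ramsey_number H1 H2) H1 H2"
proof -
  let ?a = "card (verts H1)" and ?b = "card (verts H2)"
  obtain N :: nat where N: "partn_lst {..<N} [?a, ?b] 2"
    using ramsey2_full by blast
  have "ramsey_arrows N H1 H2"
    unfolding ramsey_arrows_def
  proof (intro allI impI, elim conjE)
    fix R B :: "nat graph"
    assume V: "verts R = {1..N}" "verts B = {1..N}"
      and E: "edges R \<union> edges B = edges (complete_graph N)" "edges R \<inter> edges B = {}"
    define c :: "nat set \<Rightarrow> nat" where "c e = (if Suc ` e \<in> edges R then 0 else 1)" for e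
    have "c \<in> [{..<N}]\<^bsup>2\<^esup> \<rightarrow> {..<length [?a, ?b]}" by (auto simp: c_def)
    with N obtain i K where i: "i < length [?a, ?b]" and K: "K \<in> [{..<N}]\<^bsup>([?a, ?b] ! i)\<^esup>"
      and mono: "c ` [K]\<^bsup>2\<^esup> \<subseteq> {i}"
      using partn_lstE[OF _ _ refl] by blast
    have sub: "Suc ` K \<subseteq> {1..N}" and fin: "finite (Suc ` K)"
      and crd: "card (Suc ` K) = [?a, ?b] ! i"
      using K by (auto simp: nsets_def card_image)
    have col: "\<exists>e'. e = Suc ` e' \<and> c e' = i \<and> e \<in> edges R \<union> edges B" if e: "e \<in> [Suc ` K]\<^bsup>2\<^esup>" for e
    proof -
      obtain e' where e': "e' \<in> [K]\<^bsup>2\<^esup>" "e = Suc ` e'"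
        using e nset_image_obtains by (metis inj_Suc)
      moreover have "e \<in> edges (complete_graph N)"
        using e nsets_mono[OF sub, of 2] by (auto simp: complete_graph_def)
      ultimately show ?thesis using mono E by blast
    qed
    consider "i = 0" | "i = 1" using i by fastforce
    then show "contains_copy H1 R \<or> contains_copy H2 B"
    proof cases
      case 1
      then have "[Suc ` K]\<^bsup>2\<^esup> \<subseteq> edges R"
        using col by (force simp: c_def split: if_splits)
      then show ?thesis
        using contains_copy_if_clique[OF assms(1) fin, of R] crd 1 sub V by simp
    next
      case 2
      then have "[Suc ` K]\<^bsup>2\<^esup> \<subseteq> edges B"
        using col by (force simp: c_def split: if_splits)
      then show ?thesis
        using contains_copy_if_clique[OF assms(2) fin, of B] crd 2 sub V by simp
    qed
  qed
  then show ?thesis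
    unfolding ramsey_number_def by (rule LeastI)
qed

end

theory Submission
  imports Defs "HOL-Library.FuncSet"
begin

text \<open>
  A connected graph \<open>G\<close> of order \<open>n\<close> that is 3-good arrows already on \<open>2n - 1\<close> vertices.  Colour
  \<open>{1..2n-1}\<close> by residues modulo 5 and make an edge red when its residues are adjacent in the
  5-cycle.  The red graph is a blow-up of the pentagon, hence triangle-free, so the blue graph
  contains a copy of \<open>G\<close>.  The copy splits the vertices of \<open>G\<close> into five classes of size at most
  about \<open>2n/5\<close>, with no edges of \<open>G\<close> between cyclically consecutive classes.  A class of size at
  least \<open>n/5\<close> has two neighbouring classes; either these contain \<open>99n/1000\<close> vertices together, or
  the two remaining, mutually consecutive classes are both large.  In each case \<open>G\<close> has a hole:
  disjoint sets \<open>A\<close>, \<open>B\<close> without edges between them, with \<open>|A| \<ge> n/5\<close> and \<open>|B| \<ge> 99n/1000\<close>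
  (\<open>arrows_imp_hole\<close>).

  Holes are rare in connected 100-regular graphs.  For fixed \<open>A\<close>, \<open>B\<close> let \<open>u k\<close> be the number of
  such graphs with exactly \<open>k\<close> edges between \<open>A\<close> and \<open>B\<close>.  Replacing edges \<open>ax\<close>, \<open>by\<close> with \<open>a \<in> A\<close>,
  \<open>b \<in> B\<close> by \<open>ab\<close>, \<open>xy\<close> preserves degrees and creates one or two new edges between \<open>A\<close> and \<open>B\<close>.
  Connectedness survives if \<open>ax\<close> and \<open>by\<close> avoid a fixed spanning tree.  A spanning tree has fewer
  than \<open>n\<close> edges and so blocks only a small part of the roughly \<open>100|A|\<close> and \<open>100|B|\<close> choices:
  each graph with fewer than \<open>n\<close> cross edges admits \<open>F \<ge> 137 n\<^sup>2\<close> switchings (\<open>many_moves\<close>).  Conversely a graph with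
  \<open>k + 1\<close> cross edges arises in at most \<open>(k + 1) \<cdot> 100n\<close> ways from graphs with \<open>k\<close>.  Double counting
  (\<open>switching_inequality\<close>) gives, up to the small contribution of \<open>u (k + 2)\<close>,
  \<open>u k \<le> (k + 1) \<cdot> 100n / F \<cdot> u (k + 1)\<close>.  Iterating \<open>n\<close> times (\<open>factorial_recursion_bound\<close>)
  bounds the proportion of graphs in which \<open>A\<close>, \<open>B\<close> is a hole by \<open>n! (3 / 4n)\<^sup>n\<close>.  There are at
  most \<open>3\<^sup>n\<close> pairs \<open>(A, B)\<close>, and \<open>3\<^sup>n n! (3 / 4n)\<^sup>n\<close> tends to \<open>0\<close> because consecutive ratios
  tend to \<open>9 / 4e < 1\<close>.
\<close>

section \<open>Graphs, neighbourhoods and switchings\<close>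

definition nbrs :: "'a graph \<Rightarrow> 'a \<Rightarrow> 'a set" where
  "nbrs G v = {w. {v, w} \<in> edges G}"

definition cross :: "'a set \<Rightarrow> 'a set \<Rightarrow> 'a graph \<Rightarrow> ('a \<times> 'a) set" where
  "cross A B G = {(a, b). a \<in> A \<and> b \<in> B \<and> {a, b} \<in> edges G}"

definition conn_reg :: "'a set \<Rightarrow> nat \<Rightarrow> 'a graph set" where
  "conn_reg V d = {G. verts G = V \<and> connected_graph G \<and> regular_graph d G}"

definition switch :: "('a \<times> 'a) \<times> ('a \<times> 'a) \<Rightarrow> 'a graph \<Rightarrow> 'a graph" where
  "switch = (\<lambda>((a, x), (b, y)) G. (verts G, (edges G - {{a, x}, {b, y}}) \<union> {{a, b}, {x, y}}))"

text \<open>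
  The conditions \<open>x \<notin> B\<close> and \<open>y \<notin> A\<close> ensure that no edge between \<open>A\<close> and \<open>B\<close> is destroyed.
  Connectedness of the result is part of the definition because the switchings act on the set of
  connected graphs.
\<close>

definition moves :: "'a set \<Rightarrow> 'a set \<Rightarrow> 'a graph \<Rightarrow> (('a \<times> 'a) \<times> ('a \<times> 'a)) set" where
  "moves A B G = {((a, x), (b, y)). a \<in> A \<and> x \<notin> B \<and> b \<in> B \<and> y \<notin> A \<and>
     {a, x} \<in> edges G \<and> {b, y} \<in> edges G \<and> {a, b} \<notin> edges G \<and> x \<noteq> y \<and> {x, y} \<notin> edges G \<and>
     connected_graph (switch ((a, x), (b, y)) G)}"

lemma edge_verts:
  assumes "simple_graph G" "{u, v} \<in> edges G"
  shows "u \<in> verts G" "v \<in> verts G" "u \<noteq> v"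
proof -
  have "{u, v} \<in> [verts G]\<^bsup>2\<^esup>" using assms unfolding simple_graph_def by blast
  then show "u \<in> verts G" "v \<in> verts G" "u \<noteq> v" by (auto simp: nsets_def card_2_iff doubleton_eq_iff)
qed

lemma finite_edges: "simple_graph G \<Longrightarrow> finite (edges G)"
  by (meson finite_imp_finite_nsets finite_subset simple_graph_def)

lemma nbrs_subset: "simple_graph G \<Longrightarrow> nbrs G v \<subseteq> verts G"
  by (auto simp: nbrs_def dest: edge_verts)

lemma finite_nbrs: "simple_graph G \<Longrightarrow> finite (nbrs G v)"
  by (meson finite_subset nbrs_subset simple_graph_def)

lemma card_nbrs:
  assumes "simple_graph G" shows "card (nbrs G v) = graph_degree G v"
proof -
  have "bij_betw (\<lambda>w. {v, w}) (nbrs G v) {e \<in> edges G. v \<in> e}"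
  proof (rule bij_betwI')
    fix e assume e: "e \<in> {e \<in> edges G. v \<in> e}"
    then have "card e = 2" using assms by (auto simp: simple_graph_def nsets_def)
    then obtain w where "e = {v, w}" using e by (auto simp: card_2_iff)
    then show "\<exists>w\<in>nbrs G v. e = {v, w}" using e by (auto simp: nbrs_def)
  qed (auto simp: nbrs_def doubleton_eq_iff)
  then show ?thesis by (simp add: graph_degree_def bij_betw_same_card)
qed

lemma card_nbrs_le:
  assumes "regular_graph d G" shows "card (nbrs G v) \<le> d"
proof (cases "v \<in> verts G")
  case True then show ?thesis using assms card_nbrs[of G v] by (simp add: regular_graph_def)
next
  case False
  then have "nbrs G v = {}"
    using assms edge_verts(1)[of G v] by (auto simp: nbrs_def regular_graph_def simp del: fst_conv)
  then show ?thesis by simp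
qed

lemma card_Sigma_le:
  assumes "finite S" "card S \<le> m" "\<And>s. s \<in> S \<Longrightarrow> card (f s) \<le> d"
  shows "card (Sigma S f) \<le> m * d"
proof -
  have "card (Sigma S f) = card (\<Union>s\<in>S. Pair s ` f s)"
    by (rule arg_cong[where f=card]) auto
  also have "\<dots> \<le> (\<Sum>s\<in>S. card (Pair s ` f s))"
    by (rule card_UN_le[OF assms(1)])
  also have "\<dots> \<le> (\<Sum>s\<in>S. d)"
    by (rule sum_mono) (simp add: card_image inj_on_def assms(3))
  also have "\<dots> \<le> m * d" using assms(2) by simp
  finally show ?thesis .
qed

text \<open>
  A breadth-first tree, presented by its parent function \<open>p\<close> and root \<open>r\<close>: every vertex other than
  the root has an edge to a vertex nearer to the root.  A graph that keeps all these edges is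
  connected.  In this form a count of tree edges becomes a count of pairs \<open>(v, p v)\<close>.
\<close>

lemma spanning_parents:
  assumes "connected_graph G"
  obtains r p where "\<And>v. v \<in> verts G \<Longrightarrow> v \<noteq> r \<Longrightarrow> {v, p v} \<in> edges G"
    and "\<And>G'. simple_graph G' \<Longrightarrow> verts G' = verts G \<Longrightarrow>
           (\<And>v. v \<in> verts G \<Longrightarrow> v \<noteq> r \<Longrightarrow> {v, p v} \<in> edges G') \<Longrightarrow> connected_graph G'"
proof -
  define R where "R = {(x, y). {x, y} \<in> edges G}"
  have sG: "simple_graph G" using assms by (simp add: connected_graph_def)
  obtain r where r: "r \<in> verts G" using assms by (auto simp: connected_graph_def)
  define d where "d v = (LEAST k. (v, r) \<in> R ^^ k)" for v
  have "\<exists>w. {v, w} \<in> edges G \<and> d w < d v" if v: "v \<in> verts G" "v \<noteq> r" for v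
  proof -
    have "(v, r) \<in> R\<^sup>*" using assms r v unfolding R_def connected_graph_def by blast
    then have "\<exists>k. (v, r) \<in> R ^^ k" by (simp add: rtrancl_power)
    then have *: "(v, r) \<in> R ^^ d v" unfolding d_def by (rule LeastI_ex)
    then obtain m where m: "d v = Suc m" using v by (cases "d v") auto
    then obtain w where w: "(v, w) \<in> R" "(w, r) \<in> R ^^ m" using * by (metis relpow_Suc_D2)
    then have "d w \<le> m" unfolding d_def by (simp add: Least_le)
    then show ?thesis using w m by (auto simp: R_def)
  qed
  then obtain p where p: "\<And>v. v \<in> verts G \<Longrightarrow> v \<noteq> r \<Longrightarrow> {v, p v} \<in> edges G \<and> d (p v) < d v"
    by metis
  show thesis
  proof (rule that[of r p])
    show "{v, p v} \<in> edges G" if "v \<in> verts G" "v \<noteq> r" for v using p that by blast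
    fix G' :: "'a graph"
    assume G': "simple_graph G'" "verts G' = verts G"
      "\<And>v. v \<in> verts G \<Longrightarrow> v \<noteq> r \<Longrightarrow> {v, p v} \<in> edges G'"
    define R' where "R' = {(x, y). {x, y} \<in> edges G'}"
    have to_r: "(v, r) \<in> R'\<^sup>*" if "v \<in> verts G" for v using that
    proof (induction v rule: measure_induct_rule[of d])
      case (less v)
      show ?case
      proof (cases "v = r")
        case False
        then have "(v, p v) \<in> R'" "p v \<in> verts G" "d (p v) < d v"
          using G'(3) p less.prems sG by (auto simp: R'_def dest: edge_verts)
        then show ?thesis using less.IH by (meson converse_rtrancl_into_rtrancl)
      qed simp
    qed
    have "sym R'" by (auto simp: R'_def sym_def insert_commute)
    then have "(r, v) \<in> R'\<^sup>*" if "v \<in> verts G" for v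
      using to_r[OF that] by (meson symE sym_rtrancl)
    then show "connected_graph G'"
      using G' r to_r unfolding connected_graph_def R'_def[symmetric] by (metis emptyE rtrancl_trans)
  qed
qed

section \<open>Effect of a switching\<close>

lemma simple_switch:
  assumes "simple_graph G" "((a, x), (b, y)) \<in> moves A B G" "A \<inter> B = {}"
  shows "simple_graph (switch ((a, x), (b, y)) G)"
proof -
  have "a \<in> verts G" "x \<in> verts G" "b \<in> verts G" "y \<in> verts G" "a \<noteq> b" "x \<noteq> y"
    using assms by (auto simp: moves_def dest: edge_verts)
  then show ?thesis using assms(1) by (auto simp: simple_graph_def switch_def nsets_def)
qed

text \<open>
  Both the removed and the added pair of edges cover each of the four distinct vertices
  \<open>a, b, x, y\<close> exactly once.
\<close>

lemma regular_switch:
  assumes "regular_graph d G" "((a, x), (b, y)) \<in> moves A B G" "A \<inter> B = {}"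
  shows "regular_graph d (switch ((a, x), (b, y)) G)"
proof -
  let ?E = "edges G" and ?G' = "switch ((a, x), (b, y)) G"
  have s: "simple_graph G" using assms by (simp add: regular_graph_def)
  have m: "a \<in> A" "x \<notin> B" "b \<in> B" "y \<notin> A" "{a, x} \<in> ?E" "{b, y} \<in> ?E" "{a, b} \<notin> ?E" "x \<noteq> y" "{x, y} \<notin> ?E"
    using assms(2) by (auto simp: moves_def)
  have ne: "a \<noteq> x" "b \<noteq> y" "a \<noteq> b" "a \<noteq> y" "x \<noteq> b"
    using m assms(3) edge_verts[OF s] by blast+
  have deg: "graph_degree H v = (\<Sum>e\<in>edges H. of_bool (v \<in> e))" if "finite (edges H)" for H :: "'a graph" and v
    using that by (simp add: graph_degree_def Int_def conj_commute)
  have fin: "finite ?E" using s by (rule finite_edges)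
  have "graph_degree ?G' v = graph_degree G v" for v
  proof -
    let ?i = "\<lambda>e. of_bool (v \<in> e) :: nat"
    have "sum ?i ?E = sum ?i (?E - {{a, x}, {b, y}}) + sum ?i {{a, x}, {b, y}}"
      using fin m by (intro sum.subset_diff) auto
    moreover have "sum ?i ((?E - {{a, x}, {b, y}}) \<union> {{a, b}, {x, y}}) =
        sum ?i (?E - {{a, x}, {b, y}}) + sum ?i {{a, b}, {x, y}}"
      using fin m by (intro sum.union_disjoint) auto
    moreover have "sum ?i {{a, x}, {b, y}} = sum ?i {{a, b}, {x, y}}"
    proof -
      have "{a, x} \<noteq> {b, y}" "{a, b} \<noteq> {x, y}" using ne by (auto simp: doubleton_eq_iff)
      then show ?thesis using ne m(8) by (cases "v = a"; cases "v = b"; cases "v = x"; cases "v = y") auto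
    qed
    ultimately show ?thesis using fin by (subst (1 2) deg) (auto simp: switch_def)
  qed
  then show ?thesis using assms simple_switch[OF s assms(2,3)]
    by (simp add: regular_graph_def) (simp add: switch_def)
qed

lemma switch_conn_reg:
  assumes "G \<in> conn_reg V d" "m \<in> moves A B G" "A \<inter> B = {}"
  shows "switch m G \<in> conn_reg V d"
proof -
  obtain a x b y where m: "m = ((a, x), (b, y))" by (metis surj_pair)
  then show ?thesis using assms regular_switch[of d G a x b y A B]
    by (auto simp: conn_reg_def moves_def) (auto simp: switch_def)
qed

lemma cross_switch:
  assumes "((a, x), (b, y)) \<in> moves A B G" "A \<inter> B = {}"
  shows "cross A B (switch ((a, x), (b, y)) G) = cross A B G \<union> {(a, b)} \<union> ({(x, y)} \<inter> A \<times> B)"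
  using assms by (auto simp: moves_def cross_def switch_def doubleton_eq_iff)

text \<open>
  A graph can be recovered from its switched graph and the switching, so double counting may use
  pairs of a switched graph and the two added edges.
\<close>

lemma switch_inverse:
  assumes "((a, x), (b, y)) \<in> moves A B G"
  shows "edges G = (edges (switch ((a, x), (b, y)) G) - {{a, b}, {x, y}}) \<union> {{a, x}, {b, y}}"
    and "verts G = verts (switch ((a, x), (b, y)) G)"
  using assms by (auto simp: moves_def switch_def)

lemma finite_cross:
  assumes "simple_graph G" shows "finite (cross A B G)"
proof (rule finite_subset)
  show "cross A B G \<subseteq> verts G \<times> verts G" using assms by (auto simp: cross_def dest: edge_verts)
  show "finite (verts G \<times> verts G)" using assms by (simp add: simple_graph_def)
qed

section \<open>Counting switchings\<close>

text \<open>
  An edge that leaves \<open>A\<close> is unusable for a switching if it ends in \<open>B\<close> or lies in the tree.  A tree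
  edge joins a vertex \<open>a \<in> A\<close> either to its parent, in at most \<open>|A|\<close> ways, or to a child, and the
  child determines the edge.
\<close>

lemma free_arcs:
  assumes G: "regular_graph d G" and A: "A \<subseteq> verts G"
  shows "d * card A \<le> card {(a, x). a \<in> A \<and> x \<notin> B \<and> {a, x} \<in> edges G \<and>
       \<not> (\<exists>v\<in>verts G. {a, x} = {v, p v})} + card (cross A B G) + card A + card (verts G)"
    (is "_ \<le> card ?P + _ + _ + _")
proof -
  have s: "simple_graph G" and fV: "finite (verts G)"
    using G by (auto simp: regular_graph_def simple_graph_def)
  have fA: "finite A" using A fV finite_subset by blast
  have P: "?P \<subseteq> verts G \<times> verts G" using s by (auto dest: edge_verts)
  have fP: "finite ?P" using P fV finite_subset by blast
  have "d * card A = card (Sigma A (nbrs G))"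
    using G A fA finite_nbrs[OF s] card_nbrs[OF s]
    by (subst card_SigmaI) (auto simp: regular_graph_def subset_iff)
  also have "\<dots> \<le> card (?P \<union> cross A B G \<union> (\<lambda>a. (a, p a)) ` A \<union> (\<lambda>x. (p x, x)) ` verts G)"
  proof (rule card_mono)
    show "finite (?P \<union> cross A B G \<union> (\<lambda>a. (a, p a)) ` A \<union> (\<lambda>x. (p x, x)) ` verts G)"
      using fP fA fV finite_cross[OF s] by blast
    show "Sigma A (nbrs G) \<subseteq> ?P \<union> cross A B G \<union> (\<lambda>a. (a, p a)) ` A \<union> (\<lambda>x. (p x, x)) ` verts G"
      by (auto simp: nbrs_def cross_def doubleton_eq_iff)
  qed
  also have "\<dots> \<le> card ?P + card (cross A B G) + card ((\<lambda>a. (a, p a)) ` A) + card ((\<lambda>x. (p x, x)) ` verts G)"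
    by (meson add_le_mono1 card_Un_le order_trans)
  also have "\<dots> \<le> card ?P + card (cross A B G) + card A + card (verts G)"
    using card_image_le[OF fA] card_image_le[OF fV] by (intro add_mono) auto
  finally show ?thesis .
qed

text \<open>
  Any two edges counted by \<open>free_arcs\<close>, one at \<open>A\<close> and one at \<open>B\<close>, form a valid switching, unless
  \<open>x = y\<close> or one of the edges to be added is present already.  For a given \<open>ax\<close> these exceptions
  concern at most \<open>2d\<^sup>2 + d\<close> edges \<open>by\<close>: those with \<open>b\<close> adjacent to \<open>a\<close>, those ending in \<open>x\<close>, and
  those with \<open>y\<close> adjacent to \<open>x\<close>.
\<close>

lemma many_moves:
  assumes G: "G \<in> conn_reg V d" and AB: "A \<subseteq> V" "B \<subseteq> V" "A \<inter> B = {}"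
    and k: "card (cross A B G) = k"
    and h: "h + k + card A + card V \<le> d * card A"
    and h': "h' + k + card B + card V + (2 * d * d + d) \<le> d * card B"
  shows "h * h' \<le> card (moves A B G)"
proof -
  have reg: "regular_graph d G" and con: "connected_graph G" and V: "verts G = V"
    using G by (auto simp: conn_reg_def)
  have s: "simple_graph G" and fV: "finite V"
    using reg V by (auto simp: regular_graph_def simple_graph_def)
  obtain r p where p: "\<And>G'. simple_graph G' \<Longrightarrow> verts G' = verts G \<Longrightarrow>
           (\<And>v. v \<in> verts G \<Longrightarrow> v \<noteq> r \<Longrightarrow> {v, p v} \<in> edges G') \<Longrightarrow> connected_graph G'"
    and pG: "\<And>v. v \<in> verts G \<Longrightarrow> v \<noteq> r \<Longrightarrow> {v, p v} \<in> edges G"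
    using spanning_parents[OF con] by metis
  define P where "P A B = {(a, x). a \<in> A \<and> x \<notin> B \<and> {a, x} \<in> edges G \<and>
       \<not> (\<exists>v\<in>verts G. {a, x} = {v, p v})}" for A B
  have fP: "finite (P A B)" for A B
  proof (rule finite_subset)
    show "P A B \<subseteq> V \<times> V" using s V by (auto simp: P_def dest: edge_verts)
  qed (use fV in simp)
  define bad where "bad = (\<lambda>(a, x). (SIGMA b:nbrs G a. nbrs G b) \<union> (\<lambda>b. (b, x)) ` nbrs G x \<union>
      (\<lambda>(y, b). (b, y)) ` (SIGMA y:nbrs G x. nbrs G y))"
  \<comment> \<open>\<open>bad (a, x)\<close> contains every edge \<open>(b, y)\<close> with \<open>ab\<close> or \<open>xy\<close> an edge, or with \<open>y = x\<close>.\<close>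
  have cbad: "card (bad c) \<le> 2 * d * d + d" for c
  proof -
    obtain a x where c: "c = (a, x)" by (cases c)
    have 2: "card (SIGMA u:nbrs G v. nbrs G u) \<le> d * d" for v
      by (rule card_Sigma_le[OF finite_nbrs[OF s] card_nbrs_le[OF reg] card_nbrs_le[OF reg]])
    have fin: "finite (SIGMA u:nbrs G v. nbrs G u)" for v
      by (intro finite_SigmaI finite_nbrs[OF s])
    let ?X = "SIGMA b:nbrs G a. nbrs G b" and ?Y = "(\<lambda>b. (b, x)) ` nbrs G x"
      and ?Z = "(\<lambda>(y, b). (b, y)) ` (SIGMA y:nbrs G x. nbrs G y)"
    have "card (bad c) = card (?X \<union> ?Y \<union> ?Z)" by (simp add: bad_def c)
    also have "\<dots> \<le> card ?X + card ?Y + card ?Z"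
      using card_Un_le[of "?X \<union> ?Y" ?Z] card_Un_le[of ?X ?Y] by linarith
    also have "\<dots> \<le> d * d + d + d * d"
    proof (intro add_mono)
      show "card ?Y \<le> d"
        using card_image_le[OF finite_nbrs[OF s]] card_nbrs_le[OF reg] by (rule order_trans)
      show "card ?Z \<le> d * d" using card_image_le[OF fin] 2 by (rule order_trans)
    qed (rule 2)
    finally show ?thesis by simp
  qed
  have "cross B A G = prod.swap ` cross A B G" by (auto simp: cross_def insert_commute)
  then have k': "card (cross B A G) = k" using k by (simp add: card_image)
  have hA: "h \<le> card (P A B)"
    using free_arcs[OF reg, of A B p] AB V k h by (simp add: P_def)
  have hB: "h' + (2 * d * d + d) \<le> card (P B A)"
    using free_arcs[OF reg, of B A p] AB V k' h' by (simp add: P_def)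
  have sub: "(SIGMA c:P A B. P B A - bad c) \<subseteq> moves A B G"
  proof clarify
    fix a x b y assume ax: "(a, x) \<in> P A B" and by': "(b, y) \<in> P B A" "(b, y) \<notin> bad (a, x)"
    have e: "a \<in> A" "x \<notin> B" "b \<in> B" "y \<notin> A" "{a, x} \<in> edges G" "{b, y} \<in> edges G"
      using ax by' by (auto simp: P_def)
    have f: "{a, b} \<notin> edges G" "x \<noteq> y" "{x, y} \<notin> edges G"
      using by'(2) e by (auto simp: bad_def nbrs_def insert_commute)
    let ?G' = "switch ((a, x), (b, y)) G"
    have "a \<in> V" "b \<in> V" "x \<in> V" "y \<in> V" "a \<noteq> b" using e s V AB by (auto dest: edge_verts)
    then have "simple_graph ?G'"
      using f s V by (auto simp: switch_def simple_graph_def nsets_def)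
    moreover have "verts ?G' = verts G" by (simp add: switch_def)
    moreover have "{v, p v} \<in> edges ?G'" if "v \<in> verts G" "v \<noteq> r" for v
      using pG[OF that] ax by'(1) that by (auto simp: switch_def P_def)
    ultimately have "connected_graph ?G'" by (rule p)
    then show "((a, x), (b, y)) \<in> moves A B G" using e f by (simp add: moves_def)
  qed
  have "moves A B G \<subseteq> (V \<times> V) \<times> (V \<times> V)"
    using s V by (auto simp: moves_def dest: edge_verts)
  then have fm: "finite (moves A B G)" using fV by (meson finite_SigmaI finite_subset)
  have "h * h' \<le> (\<Sum>c\<in>P A B. h')" using hA by simp
  also have "\<dots> \<le> (\<Sum>c\<in>P A B. card (P B A - bad c))"
  proof (rule sum_mono)
    fix c
    have "finite (bad c)"
      by (cases c) (auto simp: bad_def intro!: finite_SigmaI finite_nbrs[OF s])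
    then show "h' \<le> card (P B A - bad c)"
      using diff_card_le_card_Diff[of "bad c" "P B A"] hB cbad[of c] by linarith
  qed
  also have "\<dots> = card (SIGMA c:P A B. P B A - bad c)" using fP by (simp add: card_SigmaI)
  also have "\<dots> \<le> card (moves A B G)" by (rule card_mono[OF fm sub])
  finally show ?thesis .
qed


lemma finite_conn_reg:
  assumes "finite V" shows "finite (conn_reg V d)"
proof (rule finite_subset)
  show "conn_reg V d \<subseteq> {V} \<times> Pow ([V]\<^bsup>2\<^esup>)"
    by (auto simp: conn_reg_def connected_graph_def simple_graph_def)
  show "finite ({V} \<times> Pow ([V]\<^bsup>2\<^esup>))" using assms by (simp add: finite_imp_finite_nsets)
qed

text \<open>
  Double counting of the switchings that start from graphs with \<open>k\<close> cross edges.  If a switching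
  creates one cross edge, then the result has \<open>k + 1\<close> candidates for the edge \<open>ab\<close> and \<open>d|V|\<close> for the
  oriented edge \<open>xy\<close>.  If \<open>x \<in> A\<close> and \<open>y \<in> B\<close>, then it creates two, and \<open>ab\<close>, \<open>xy\<close> are distinct
  elements of the \<open>k + 2\<close> cross edges.
\<close>

lemma switching_inequality:
  fixes V A B :: "'a set"
  defines "N \<equiv> \<lambda>d k. {G \<in> conn_reg V d. card (cross A B G) = k}"
  assumes V: "finite V" and AB: "A \<inter> B = {}"
    and F: "\<And>G. G \<in> N d k \<Longrightarrow> F \<le> card (moves A B G)"
  shows "card (N d k) * F \<le>
    card (N d (k + 1)) * ((k + 1) * (card V * d)) + card (N d (k + 2)) * ((k + 2) * (k + 1))"
proof -
  have finN: "finite (N d j)" for j using finite_conn_reg[OF V] by (simp add: N_def)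
  have s: "simple_graph G" "regular_graph d G" "verts G = V" if "G \<in> N d j" for G j
    using that by (auto simp: N_def conn_reg_def regular_graph_def)
  have fm: "finite (moves A B G)" if "G \<in> N d j" for G j
  proof (rule finite_subset)
    show "moves A B G \<subseteq> (V \<times> V) \<times> (V \<times> V)"
      using s[OF that] by (auto simp: moves_def dest: edge_verts)
  qed (use V in simp)
  have fc: "finite (cross A B G)" and fn: "finite (nbrs G v)" if "G \<in> N d j" for G j v
    using finite_cross[OF s(1)[OF that]] finite_nbrs[OF s(1)[OF that]] by blast+
  define S where "S = (SIGMA G:N d k. moves A B G)"
  define f where "f = (\<lambda>(G :: 'a graph, (a, x), (b, y)). (switch ((a, x), (b, y)) G, (a, b), (x, y)))"
  define T1 where "T1 = (SIGMA G:N d (k + 1). cross A B G \<times> (SIGMA v:V. nbrs G v))"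
  define T2 where "T2 = (SIGMA G:N d (k + 2). SIGMA c:cross A B G. cross A B G - {c})"
  have "inj_on f S"
  proof (rule inj_onI, clarsimp simp: S_def f_def)
    fix E E' and W W' :: "'a set" and a b x y
    assume m: "((a, x), (b, y)) \<in> moves A B (W, E)" "((a, x), (b, y)) \<in> moves A B (W', E')"
      and eq: "switch ((a, x), (b, y)) (W, E) = switch ((a, x), (b, y)) (W', E')"
    show "W = W' \<and> E = E'"
      using switch_inverse[OF m(1)] switch_inverse[OF m(2)] eq by simp
  qed
  moreover have "f ` S \<subseteq> T1 \<union> T2"
  proof (clarsimp simp: S_def f_def)
    fix W E a x b y
    assume G: "(W, E) \<in> N d k" and m: "((a, x), (b, y)) \<in> moves A B (W, E)"
      and n2: "(switch ((a, x), (b, y)) (W, E), (a, b), (x, y)) \<notin> T2"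
    let ?G = "(W, E)" and ?G' = "switch ((a, x), (b, y)) (W, E)"
    have N': "?G' \<in> N d j" if "card (cross A B ?G') = j" for j
      using that G switch_conn_reg[OF _ m AB] by (simp add: N_def)
    have m': "a \<in> A" "b \<in> B" "{a, b} \<notin> E" "{x, y} \<notin> E" "{a, x} \<in> E" "{b, y} \<in> E"
      using m by (auto simp: moves_def)
    have cr: "cross A B ?G' = cross A B ?G \<union> {(a, b)} \<union> ({(x, y)} \<inter> A \<times> B)"
      by (rule cross_switch[OF m AB])
    have fc: "finite (cross A B ?G)" and ck: "card (cross A B ?G) = k"
      using fc[OF G] G by (auto simp: N_def)
    have new: "(a, b) \<notin> cross A B ?G" "(x, y) \<notin> cross A B ?G" using m' by (auto simp: cross_def)
    have ne: "a \<noteq> x" using m' edge_verts[OF s(1)[OF G], of a x] by auto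
    show "(?G', (a, b), (x, y)) \<in> T1"
    proof (cases "x \<in> A \<and> y \<in> B")
      case True
      then have c: "cross A B ?G' = insert (x, y) (insert (a, b) (cross A B ?G))" using cr by auto
      then have "card (cross A B ?G') = k + 2" using fc ck new ne by simp
      then have "(?G', (a, b), (x, y)) \<in> T2" using N' c ne by (auto simp: T2_def)
      then show ?thesis using n2 by blast
    next
      case False
      then have c: "cross A B ?G' = insert (a, b) (cross A B ?G)" using cr by auto
      then have "card (cross A B ?G') = k + 1" using fc ck new by simp
      moreover have "y \<in> nbrs ?G' x" by (simp add: nbrs_def switch_def)
      moreover have "x \<in> V" using m' edge_verts[OF s(1)[OF G], of a x] s(3)[OF G] by simp
      ultimately show ?thesis using N' c by (simp add: T1_def)
    qed
  qed
  moreover have "finite T1"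
    unfolding T1_def by (intro finite_SigmaI finN V fc fn)
  moreover have "finite T2"
    unfolding T2_def by (intro finite_SigmaI finite_Diff finN fc)
  ultimately have "card S \<le> card (T1 \<union> T2)"
    by (metis card_image card_mono finite_UnI)
  also have "\<dots> \<le> card T1 + card T2" by (rule card_Un_le)
  also have "card T1 \<le> card (N d (k + 1)) * ((k + 1) * (card V * d))"
    unfolding T1_def
  proof (rule card_Sigma_le[OF finN order_refl])
    fix G assume G: "G \<in> N d (k + 1)"
    have "card (SIGMA v:V. nbrs G v) \<le> card V * d"
      using card_nbrs_le[OF s(2)[OF G]] by (intro card_Sigma_le[OF V]) auto
    then show "card (cross A B G \<times> (SIGMA v:V. nbrs G v)) \<le> (k + 1) * (card V * d)"
      using G unfolding card_cartesian_product by (intro mult_mono) (auto simp: N_def)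
  qed
  also have "card T2 \<le> card (N d (k + 2)) * ((k + 2) * (k + 1))"
    unfolding T2_def
  proof (rule card_Sigma_le[OF finN order_refl])
    fix G assume G: "G \<in> N d (k + 2)"
    have "finite (cross A B G)" using finite_cross s(1)[OF G] by blast
    then show "card (SIGMA c:cross A B G. cross A B G - {c}) \<le> (k + 2) * (k + 1)"
      using G by (intro card_Sigma_le) (auto simp: N_def)
  qed
  finally have "card S \<le> card (N d (k + 1)) * ((k + 1) * (card V * d)) + card (N d (k + 2)) * ((k + 2) * (k + 1))"
    by simp
  moreover have "card (N d k) * F \<le> card S"
  proof -
    have "card (N d k) * F \<le> (\<Sum>G\<in>N d k. card (moves A B G))"
      using sum_mono[of "N d k" "\<lambda>_. F", OF F] by simp
    also have "\<dots> = card S" unfolding S_def using finN fm by (subst card_SigmaI) auto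
    finally show ?thesis .
  qed
  ultimately show ?thesis by linarith
qed

section \<open>Proportion of graphs with a given hole\<close>

text \<open>
  The sequence \<open>c k = M K! q\<^sup>K / (k! q\<^sup>k)\<close> is a supersolution of the recursion: substituting it on
  the right-hand side produces \<open>c k (P q + S) / q\<^sup>2 \<le> c k\<close>.  The recursion has order two, so
  downward induction starts from \<open>K\<close>, where \<open>c K = M\<close>, and from \<open>K + 1\<close>, where
  \<open>c (K + 1) = M / ((K + 1) q) \<ge> M\<close>.
\<close>

lemma factorial_recursion_bound:
  fixes u :: "nat \<Rightarrow> real"
  assumes u: "\<And>k. u k \<le> M" and M: "0 \<le> M"
    and rec: "\<And>k. k < K \<Longrightarrow> u k \<le> (real k + 1) * P * u (k + 1) + (real k + 1) * (real k + 2) * S * u (k + 2)"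
    and P: "0 \<le> P" and S: "0 \<le> S" and q: "0 < q" "P * q + S \<le> q\<^sup>2" "(real K + 1) * q \<le> 1"
  shows "u 0 \<le> M * (fact K * q ^ K)"
proof -
  define X where "X = M * (fact K * q ^ K)"
  have X: "0 \<le> X" using M q by (simp add: X_def)
  define c where "c k = X / (fact k * q ^ k)" for k
  have c1: "(real k + 1) * c (k + 1) = c k / q" for k
    using q by (simp add: c_def divide_simps)
  have c2: "(real k + 1) * (real k + 2) * c (k + 2) = c k / q\<^sup>2" for k
  proof -
    have "(real k + 2) * c (k + 2) = c (k + 1) / q"
      using c1[of "k + 1"] by (simp add: add.commute)
    then have "(real k + 1) * (real k + 2) * c (k + 2) = (real k + 1) * c (k + 1) / q"
      by (simp only: mult.assoc times_divide_eq_right)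
    also have "\<dots> = c k / q\<^sup>2" unfolding c1 by (simp add: power2_eq_square)
    finally show ?thesis .
  qed
  have "u k \<le> c k" if "k \<le> K + 1" for k
    using that
  proof (induction "K + 1 - k" arbitrary: k rule: less_induct)
    case less
    consider "k = K + 1" | "k = K" | "k < K" using less.prems by linarith
    then show ?case
    proof cases
      case 1
      have "(real K + 1) * c (K + 1) = M / q" using c1[of K] q by (simp add: c_def X_def)
      then have "c (K + 1) = M / q / (real K + 1)" using q by (simp add: eq_divide_eq mult_ac)
      then have "c (K + 1) = M / ((real K + 1) * q)" by (simp add: mult.commute)
      moreover have "M \<le> M / ((real K + 1) * q)"
        using q M by (simp add: le_divide_eq mult_left_le)
      ultimately show ?thesis using u[of "K + 1"] 1 by simp
    next
      case 2
      then show ?thesis using u q by (simp add: c_def X_def)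
    next
      case 3
      have ih: "u (k + 1) \<le> c (k + 1)" "u (k + 2) \<le> c (k + 2)" using less.hyps 3 by auto
      have "u k \<le> (real k + 1) * P * u (k + 1) + (real k + 1) * (real k + 2) * S * u (k + 2)" by (rule rec[OF 3])
      also have "\<dots> \<le> (real k + 1) * P * c (k + 1) + (real k + 1) * (real k + 2) * S * c (k + 2)"
        using ih P S by (intro add_mono mult_left_mono) auto
      also have "\<dots> = P * ((real k + 1) * c (k + 1)) + S * ((real k + 1) * (real k + 2) * c (k + 2))"
        by (simp add: algebra_simps)
      also have "\<dots> = c k * ((P * q + S) / q\<^sup>2)"
        unfolding c1 c2 using q by (simp add: field_simps power2_eq_square)
      also have "\<dots> \<le> c k * 1"
        using q X by (intro mult_left_mono) (auto simp: c_def)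
      finally show ?thesis by simp
    qed
  qed
  from this[of 0] show ?thesis by (simp add: c_def X_def)
qed

text \<open>
  With fewer than \<open>n\<close> cross edges and at most \<open>n + |A|\<close> tree edges blocked, at least
  \<open>99|A| - 2n \<ge> 17.8n\<close> of the \<open>100|A|\<close> edges at \<open>A\<close> are usable.  The same count at \<open>B\<close> leaves
  \<open>99|B| - 2n \<ge> 7.801n\<close>; the \<open>2 \<cdot> 100\<^sup>2 + 100 = 20100\<close> exceptions of \<open>many_moves\<close> lower this to
  \<open>7.7n\<close> for large \<open>n\<close>.  The product exceeds \<open>137n\<^sup>2\<close>, and \<open>76 / 137 < 9 / 16\<close> makes
  \<open>q = 3 / (4n)\<close> admissible in \<open>factorial_recursion_bound\<close>.
\<close>

lemma hole_proportion:
  assumes V: "finite V" "card V = n" and n: "200000 \<le> n"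
    and AB: "A \<subseteq> V" "B \<subseteq> V" "A \<inter> B = {}" "n \<le> 5 * card A" "99 * n \<le> 1000 * card B"
  shows "real (card {G \<in> conn_reg V 100. cross A B G = {}})
    \<le> real (card (conn_reg V 100)) * (fact n * (3 / (4 * real n)) ^ n)"
proof -
  define N where "N k = {G \<in> conn_reg V 100. card (cross A B G) = k}" for k
  define h where "h = 99 * card A - 2 * n"
  define h' where "h' = 99 * card B - 2 * n - 20100"
  define F where "F = real (h * h')"
  have hr: "real h \<ge> 178 / 10 * n" "real h' \<ge> 77 / 10 * n"
    using AB n unfolding h_def h'_def by linarith+
  have "137 * (real n * real n) \<le> (178 / 10 * n) * (77 / 10 * n)" by simp
  also have "\<dots> \<le> F" unfolding F_def of_nat_mult using hr by (intro mult_mono) auto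
  finally have F: "137 * (real n * real n) \<le> F" .
  have n0: "0 < real n * real n" using n by simp
  have F0: "0 < F" using F n0 by linarith
  have fin: "finite (conn_reg V 100)" using V finite_conn_reg by blast
  have "real (card (N 0)) \<le> card (conn_reg V 100) * (fact n * (3 / (4 * real n)) ^ n)"
  proof (rule factorial_recursion_bound[where u = "\<lambda>k. card (N k)" and P = "100 * real n / F" and S = "1 / F"])
    show "real (card (N k)) \<le> card (conn_reg V 100)" for k
      using fin by (auto simp: N_def intro: card_mono)
    show "real (card (N k)) \<le> (real k + 1) * (100 * real n / F) * card (N (k + 1)) +
        (real k + 1) * (real k + 2) * (1 / F) * card (N (k + 2))" if k: "k < n" for k
    proof -
      have "h * h' \<le> card (moves A B G)" if "G \<in> N k" for G
      proof (rule many_moves)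
        show "G \<in> conn_reg V 100" "card (cross A B G) = k" using that by (auto simp: N_def)
        show "h + k + card A + card V \<le> 100 * card A"
          using AB k V n unfolding h_def by linarith
        show "h' + k + card B + card V + (2 * 100 * 100 + 100) \<le> 100 * card B"
          using AB k V n unfolding h'_def by linarith
      qed (use AB in auto)
      then have "card (N k) * (h * h') \<le>
         card (N (k + 1)) * ((k + 1) * (card V * 100)) + card (N (k + 2)) * ((k + 2) * (k + 1))"
        unfolding N_def by (rule switching_inequality[OF V(1) AB(3)])
      then have "real (card (N k) * (h * h')) \<le>
         real (card (N (k + 1)) * ((k + 1) * (card V * 100)) + card (N (k + 2)) * ((k + 2) * (k + 1)))"
        by (simp only: of_nat_le_iff)
      then have "real (card (N k)) * F \<le>
        (real k + 1) * (100 * real n) * card (N (k + 1)) + (real k + 1) * (real k + 2) * card (N (k + 2))"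
        using V by (simp add: F_def algebra_simps)
      then have "real (card (N k)) \<le>
        ((real k + 1) * (100 * real n) * card (N (k + 1)) + (real k + 1) * (real k + 2) * card (N (k + 2))) / F"
        using F0 by (simp only: pos_le_divide_eq)
      then show ?thesis by (simp add: add_divide_distrib)
    qed
    show "100 * real n / F * (3 / (4 * real n)) + 1 / F \<le> (3 / (4 * real n))\<^sup>2"
    proof -
      have "100 * real n / F * (3 / (4 * real n)) + 1 / F = 76 / F"
        using n F0 by (simp add: field_simps)
      also have "\<dots> \<le> 9 / (16 * (real n * real n))"
        using F F0 n0 by (simp add: divide_simps)
      finally show ?thesis by (simp add: power2_eq_square)
    qed
    show "(real n + 1) * (3 / (4 * real n)) \<le> 1" using n by (simp add: field_simps)
  qed (use F0 n in auto)
  moreover have "{G \<in> conn_reg V 100. cross A B G = {}} = N 0"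
    using finite_cross[of _ A B] by (auto simp: N_def conn_reg_def connected_graph_def)
  ultimately show ?thesis by simp
qed

section \<open>Union bound over all holes\<close>

lemma card_disjoint_pairs:
  assumes "finite V" shows "card {(A, B). A \<subseteq> V \<and> B \<subseteq> V \<and> A \<inter> B = {}} \<le> 3 ^ card V"
proof -
  let ?S = "{(A, B). A \<subseteq> V \<and> B \<subseteq> V \<and> A \<inter> B = {}}"
  define f where "f = (\<lambda>(A, B). \<lambda>v\<in>V. if v \<in> A then 0 else if v \<in> B then 1 else 2 :: nat)"
  have "inj_on f ?S"
  proof (rule inj_onI, clarify)
    fix A B A' B' assume *: "A \<subseteq> V" "B \<subseteq> V" "A \<inter> B = {}" "A' \<subseteq> V" "B' \<subseteq> V" "A' \<inter> B' = {}"
      "f (A, B) = f (A', B')"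
    have "(v \<in> A \<longleftrightarrow> v \<in> A') \<and> (v \<in> B \<longleftrightarrow> v \<in> B')" if "v \<in> V" for v
      using fun_cong[OF *(7), of v] that *(3,6) by (auto simp: f_def split: if_splits)
    then show "A = A' \<and> B = B'" using * by blast
  qed
  moreover have "f ` ?S \<subseteq> V \<rightarrow>\<^sub>E {0, 1, 2}" by (auto simp: f_def split: if_splits)
  ultimately have "card ?S \<le> card (V \<rightarrow>\<^sub>E {0, 1, 2 :: nat})"
    by (intro card_inj_on_le) (auto intro: assms finite_PiE)
  also have "\<dots> = 3 ^ card V" using assms by (simp add: card_PiE numeral_3_eq_3)
  finally show ?thesis .
qed

text \<open>
  Consecutive terms have ratio \<open>(9 / 4) / (1 + 1 / n)\<^sup>n\<close>, whose limit \<open>9 / (4e)\<close> is less than \<open>1\<close>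
  because \<open>e \<ge> 5 / 2\<close>.
\<close>

lemma factorial_decay: "(\<lambda>n. 3 ^ n * (fact n * (3 / (4 * real n)) ^ n)) \<longlonglongrightarrow> 0"
proof -
  define x :: "nat \<Rightarrow> real" where "x n = 3 ^ n * (fact n * (3 / (4 * real n)) ^ n)" for n
  have "(\<lambda>n. (1 + 1 / real n) ^ n) \<longlonglongrightarrow> exp 1"
    by (rule tendsto_exp_limit_sequentially)
  moreover have "(5 / 2 :: real) \<le> exp 1"
    using exp_lower_Taylor_quadratic[of 1] by simp
  \<comment> \<open>The threshold lies between \<open>9 / 4\<close> and \<open>5 / 2\<close>; it gives the ratio \<open>(9 / 4) / (24 / 10) = 15 / 16\<close>.\<close>
  ultimately have "eventually (\<lambda>n. (1 + 1 / real n) ^ n > 24 / 10) sequentially"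
    by (intro order_tendstoD) auto
  then obtain n0 where n0: "\<And>n. n \<ge> n0 \<Longrightarrow> (1 + 1 / real n) ^ n > 24 / 10"
    by (auto simp: eventually_sequentially)
  have "summable x"
  proof (rule summable_ratio_test[where c = "15 / 16" and N = "max 1 n0"])
    fix n assume n: "max 1 n0 \<le> n"
    then have pos: "0 < real n" by simp
    have xe: "x m = fact m * (9 / (4 * real m)) ^ m" for m
      by (simp add: x_def mult.left_commute[of "3 ^ m"] flip: power_mult_distrib)
    have "x (Suc n) * (1 + 1 / real n) ^ n =
        fact n * (real (Suc n) * (9 / (4 * real (Suc n)))) * (9 / (4 * real (Suc n)) * (1 + 1 / real n)) ^ n"
      unfolding xe power_mult_distrib by (simp add: power_mult_distrib del: of_nat_Suc)
    also have "9 / (4 * real (Suc n)) * (1 + 1 / real n) = 9 / (4 * real n)"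
    proof -
      have "9 / (4 * real (Suc n)) * (real (Suc n) / real n) = 9 / (4 * real n)"
        by (simp del: of_nat_Suc)
      moreover have "1 + 1 / real n = real (Suc n) / real n" using pos by (simp add: field_simps)
      ultimately show ?thesis by (simp only:)
    qed
    also have "real (Suc n) * (9 / (4 * real (Suc n))) = 9 / 4" by (simp del: of_nat_Suc)
    finally have "x (Suc n) * (1 + 1 / real n) ^ n = 9 / 4 * x n" by (simp add: xe)
    moreover have "24 / 10 * x (Suc n) \<le> x (Suc n) * (1 + 1 / real n) ^ n"
      using n0[of n] n by (subst mult.commute, intro mult_left_mono) (auto simp: x_def)
    ultimately have "x (Suc n) \<le> 15 / 16 * x n" by simp
    then show "norm (x (Suc n)) \<le> 15 / 16 * norm (x n)" by (simp add: x_def)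
  qed simp
  then have "x \<longlonglongrightarrow> 0" by (rule summable_LIMSEQ_zero)
  then show ?thesis by (simp add: x_def[abs_def])
qed

section \<open>A colouring that forces holes\<close>

definition pentagon_blowup :: "nat \<Rightarrow> nat graph" where
  "pentagon_blowup N = ({1..N}, {{u, v} |u v. u \<in> {1..N} \<and> v \<in> {1..N} \<and> v mod 5 = (u + 1) mod 5})"

lemma mod_5_Suc_neq: "(i + 1) mod 5 \<noteq> i mod (5 :: nat)"
  by presburger

lemma pentagon_blowup_edge:
  "{u, v} \<in> edges (pentagon_blowup N) \<longleftrightarrow>
     u \<in> {1..N} \<and> v \<in> {1..N} \<and> (v mod 5 = (u + 1) mod 5 \<or> u mod 5 = (v + 1) mod 5)"
  by (auto simp: pentagon_blowup_def doubleton_eq_iff)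

lemma pentagon_blowup_subset: "edges (pentagon_blowup N) \<subseteq> edges (complete_graph N)"
proof
  fix e assume "e \<in> edges (pentagon_blowup N)"
  then obtain u v where e: "e = {u, v}" "u \<in> {1..N}" "v \<in> {1..N}" "v mod 5 = (u + 1) mod 5"
    by (auto simp: pentagon_blowup_def)
  then have "u \<noteq> v" using mod_5_Suc_neq[of u] by auto
  then show "e \<in> edges (complete_graph N)"
    using e by (auto simp: complete_graph_def nsets_def)
qed

lemma pentagon_triangle_free:
  fixes x y z :: nat
  assumes "x < 5" "y < 5" "z < 5" "y = (x + 1) mod 5 \<or> x = (y + 1) mod 5"
    "z = (y + 1) mod 5 \<or> y = (z + 1) mod 5" "z = (x + 1) mod 5 \<or> x = (z + 1) mod 5"
  shows False
proof -
  have adjacent: "v = u + 1 \<or> u = v + 1 \<or> u = 4 \<and> v = 0 \<or> u = 0 \<and> v = 4"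
    if "u < 5" "v < 5" "v = (u + 1) mod 5 \<or> u = (v + 1) mod 5" for u v :: nat
  proof -
    have "(w + 1) mod 5 = (if w = 4 then 0 else w + 1)" if "w < 5" for w :: nat
      using that by simp
    from this[of u] this[of v] that show ?thesis by (auto split: if_splits)
  qed
  show False
    using adjacent[OF assms(1,2,4)] adjacent[OF assms(2,3,5)] adjacent[OF assms(1,3,6)] assms(1-3)
    by linarith
qed

text \<open>
  A triangle would project to three pairwise adjacent vertices of the 5-cycle of residues.
\<close>

lemma pentagon_blowup_triangle_free: "\<not> contains_copy (complete_graph 3) (pentagon_blowup N)"
proof
  assume "contains_copy (complete_graph 3) (pentagon_blowup N)"
  then obtain f where f: "\<And>e. e \<in> edges (complete_graph 3) \<Longrightarrow> f ` e \<in> edges (pentagon_blowup N)"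
    by (auto simp: contains_copy_def)
  have "{1, 2} \<in> edges (complete_graph 3)" "{2, 3} \<in> edges (complete_graph 3)"
    "{1, 3} \<in> edges (complete_graph 3)"
    by (auto simp: complete_graph_def nsets_def)
  then have "{f 1, f 2} \<in> edges (pentagon_blowup N)" "{f 2, f 3} \<in> edges (pentagon_blowup N)"
    "{f 1, f 3} \<in> edges (pentagon_blowup N)"
    using f by fastforce+
  then have "(f j mod 5 = (f i mod 5 + 1) mod 5 \<or> f i mod 5 = (f j mod 5 + 1) mod 5)"
    if "(i, j) \<in> {(1, 2), (2, 3), (1, 3)}" for i j
    using that unfolding pentagon_blowup_edge by (auto simp: mod_simps)
  from this[of 1 2] this[of 2 3] this[of 1 3] show False
    by (intro pentagon_triangle_free[of "f 1 mod 5" "f 2 mod 5" "f 3 mod 5"]) simp_all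
qed

lemma card_residue_class: "5 * card {u \<in> {1..N}. u mod 5 = i} \<le> N + 5"
proof -
  have "card {u \<in> {1..N}. u mod 5 = i} \<le> card {..N div 5}"
  proof (rule card_inj_on_le)
    show "inj_on (\<lambda>u. u div 5) {u \<in> {1..N}. u mod 5 = i}"
      by (rule inj_onI) (metis (mono_tags, lifting) div_mult_mod_eq mem_Collect_eq)
    show "(\<lambda>u. u div 5) ` {u \<in> {1..N}. u mod 5 = i} \<subseteq> {..N div 5}"
      by (auto intro: div_le_mono)
  qed simp
  then show ?thesis by simp
qed

text \<open>
  The classes \<open>W i\<close> of the blue copy have size at most \<open>(2n + 4) / 5\<close>.  Let \<open>w 0\<close> be a class of size
  at least \<open>n / 5\<close>.  If its neighbours \<open>w 1\<close>, \<open>w 4\<close> together are large, they form a hole with \<open>w 0\<close>.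
  Otherwise \<open>w 2\<close> and \<open>w 3\<close> together contain at least \<open>0.901n - |w 0|\<close> vertices, about \<open>n / 2\<close>,
  and neither can hold more than about \<open>2n / 5\<close> of them; so each has at least \<open>99n / 1000\<close>, the
  larger one at least \<open>n / 5\<close>, and the two form a hole.
\<close>

lemma arrows_imp_hole:
  fixes G :: "'a graph"
  assumes G: "simple_graph G" "card (verts G) = n" "1000 \<le> n"
    and arr: "ramsey_arrows (2 * n - 1) (complete_graph 3) G"
  obtains A B where "A \<subseteq> verts G" "B \<subseteq> verts G" "A \<inter> B = {}" "cross A B G = {}"
    "n \<le> 5 * card A" "99 * n \<le> 1000 * card B"
proof -
  define N where "N = 2 * n - 1"
  define R where "R = pentagon_blowup N"
  define B :: "nat graph" where "B = ({1..N}, edges (complete_graph N) - edges R)"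
  have "verts R = {1..N}" "verts B = {1..N}" "edges R \<union> edges B = edges (complete_graph N)"
    "edges R \<inter> edges B = {}"
    using pentagon_blowup_subset[of N] by (auto simp: R_def B_def pentagon_blowup_def)
  then have "contains_copy (complete_graph 3) R \<or> contains_copy G B"
    using arr unfolding ramsey_arrows_def N_def[symmetric] by blast
  then have "contains_copy G B" using pentagon_blowup_triangle_free R_def by blast
  then obtain f where inj: "inj_on f (verts G)" and im: "f ` verts G \<subseteq> {1..N}"
    and fe: "\<And>e. e \<in> edges G \<Longrightarrow> f ` e \<notin> edges R"
    by (auto simp: contains_copy_def B_def)
  define W where "W i = {v \<in> verts G. f v mod 5 = i}" for i
  have fin: "finite (verts G)" using G by (simp add: simple_graph_def)
  have W: "W i \<subseteq> verts G" "finite (W i)" for i using fin by (auto simp: W_def)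
  have disj: "W i \<inter> W j = {}" if "i \<noteq> j" for i j using that by (auto simp: W_def)
  have cap: "5 * card (W i) \<le> 2 * n + 4" for i
  proof -
    have "card (W i) \<le> card {u \<in> {1..N}. u mod 5 = i}"
      by (rule card_inj_on_le[where f = f]) (use inj im in \<open>auto simp: W_def intro: inj_on_subset\<close>)
    then show ?thesis using card_residue_class[of N i] G(3) by (simp add: N_def)
  qed
  have empty: "cross (W i) (W j) G = {}" if "j = (i + 1) mod 5 \<or> i = (j + 1) mod 5" for i j
  proof -
    have False if uv: "u \<in> W i" "v \<in> W j" "{u, v} \<in> edges G" for u v
    proof -
      have "{f u, f v} \<notin> edges R" using fe[OF uv(3)] by simp
      moreover have "f u \<in> {1..N}" "f v \<in> {1..N}" using im uv by (auto simp: W_def)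
      moreover have "f v mod 5 = (f u + 1) mod 5 \<or> f u mod 5 = (f v + 1) mod 5"
        using that \<open>j = (i + 1) mod 5 \<or> i = (j + 1) mod 5\<close> by (auto simp: W_def mod_Suc_eq)
      ultimately show False unfolding R_def pentagon_blowup_edge by blast
    qed
    then show ?thesis by (auto simp: cross_def)
  qed
  have "verts G = (\<Union>i<5. W i)" by (auto simp: W_def)
  then have "n = (\<Sum>i<5. card (W i))"
    using G(2) W disj by (simp add: card_UN_disjoint)
  then have total: "n = card (W 0) + card (W 1) + card (W 2) + card (W 3) + card (W 4)"
    by (simp add: eval_nat_numeral)
  obtain i where i: "i < 5" "n \<le> 5 * card (W i)"
  proof -
    have "n \<le> 5 * card (W 0) \<or> n \<le> 5 * card (W 1) \<or> n \<le> 5 * card (W 2) \<or> n \<le> 5 * card (W 3) \<or>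
      n \<le> 5 * card (W 4)" using total by linarith
    then show thesis using that[of 0] that[of 1] that[of 2] that[of 3] that[of 4] by auto
  qed
  \<comment> \<open>Rotate the classes so that the large class gets index 0.\<close>
  define w where "w j = W ((i + j) mod 5)" for j
  have i5: "i = 0 \<or> i = 1 \<or> i = 2 \<or> i = 3 \<or> i = 4" using i(1) by linarith
  have sum: "n = card (w 0) + card (w 1) + card (w 2) + card (w 3) + card (w 4)"
  proof -
    from i5 consider "i = 0" | "i = 1" | "i = 2" | "i = 3" | "i = 4" by blast
    then show ?thesis using total by cases (simp_all add: w_def numeral_2_eq_2)
  qed
  have w: "w j \<subseteq> verts G" "finite (w j)" "5 * card (w j) \<le> 2 * n + 4" for j
    using W cap by (auto simp: w_def)
  have adj: "cross (w 0) (w 1) G = {} \<and> cross (w 0) (w 4) G = {} \<and> cross (w 2) (w 3) G = {} \<and>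
    cross (w 3) (w 2) G = {}"
    and dis: "w 0 \<inter> w 1 = {} \<and> w 0 \<inter> w 4 = {} \<and> w 1 \<inter> w 4 = {} \<and> w 2 \<inter> w 3 = {}"
  proof -
    from i5 consider "i = 0" | "i = 1" | "i = 2" | "i = 3" | "i = 4" by blast
    then show "cross (w 0) (w 1) G = {} \<and> cross (w 0) (w 4) G = {} \<and> cross (w 2) (w 3) G = {} \<and>
        cross (w 3) (w 2) G = {}"
      by cases (simp_all add: w_def empty)
    from i5 consider "i = 0" | "i = 1" | "i = 2" | "i = 3" | "i = 4" by blast
    then show "w 0 \<inter> w 1 = {} \<and> w 0 \<inter> w 4 = {} \<and> w 1 \<inter> w 4 = {} \<and> w 2 \<inter> w 3 = {}"
      by cases (simp_all add: w_def disj)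
  qed
  have w0: "n \<le> 5 * card (w 0)" using i by (simp add: w_def)
  define t where "t = card (w 1) + card (w 4)"
  have sum': "n = card (w 0) + t + card (w 2) + card (w 3)" using sum by (simp add: t_def)
  show thesis
  proof (cases "99 * n \<le> 1000 * t")
    case True
    show thesis
    proof (rule that[of "w 0" "w 1 \<union> w 4"])
      show "cross (w 0) (w 1 \<union> w 4) G = {}" using adj by (auto simp: cross_def)
      show "99 * n \<le> 1000 * card (w 1 \<union> w 4)" using True w dis by (simp add: card_Un_disjoint t_def)
    qed (use w w0 dis in auto)
  next
    case False
    have w1000: "1000 * card (w j) \<le> 400 * n + 800" for j using w(3)[of j] by linarith
    have sum1000: "1000 * n = 1000 * card (w 0) + 1000 * t + 1000 * card (w 2) + 1000 * card (w 3)"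
      using sum' by simp
    have big: "99 * n \<le> 1000 * card (w 2)"
      using False sum1000 w1000[of 0] w1000[of 3] G(3) by linarith
    have big': "99 * n \<le> 1000 * card (w 3)"
      using False sum1000 w1000[of 0] w1000[of 2] G(3) by linarith
    consider "n \<le> 5 * card (w 2)" | "n \<le> 5 * card (w 3)"
      using False sum1000 w1000[of 0] G(3) by linarith
    then show thesis
    proof cases
      case 1
      show thesis by (rule that[of "w 2" "w 3"]) (use w(1) 1 big' dis adj in auto)
    next
      case 2
      show thesis by (rule that[of "w 3" "w 2"]) (use w(1) 2 big dis adj in auto)
    qed
  qed
qed

lemma good_imp_hole:
  fixes G :: "'a graph"
  assumes "p_good 3 G" "card (verts G) = n" "1000 \<le> n"
  obtains A B where "A \<subseteq> verts G" "B \<subseteq> verts G" "A \<inter> B = {}" "cross A B G = {}"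
    "n \<le> 5 * card A" "99 * n \<le> 1000 * card B"
proof -
  have s: "simple_graph G" using assms by (simp add: p_good_def connected_graph_def)
  have "simple_graph (complete_graph 3)" by (simp add: simple_graph_def complete_graph_def)
  moreover have "ramsey_number (complete_graph 3) G = 2 * n - 1"
    using assms by (simp add: p_good_def)
  ultimately have "ramsey_arrows (2 * n - 1) (complete_graph 3) G"
    using ramsey_arrows_ramsey_number s by metis
  then show thesis using arrows_imp_hole[OF s assms(2,3)] that by blast
qed

section \<open>Proportion of 3-good graphs\<close>

lemma good_proportion:
  assumes V: "finite V" "card V = n" and n: "200000 \<le> n"
  shows "real (card {G \<in> conn_reg V 100. p_good 3 G}) / real (card (conn_reg V 100))
    \<le> 3 ^ n * (fact n * (3 / (4 * real n)) ^ n)"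
proof -
  let ?C = "conn_reg V 100"
  define D where "D = {(A, B). A \<subseteq> V \<and> B \<subseteq> V \<and> A \<inter> B = {}}"
  define D' where "D' = {(A, B) \<in> D. n \<le> 5 * card A \<and> 99 * n \<le> 1000 * card B}"
  define H where "H = (\<lambda>(A, B). {G \<in> ?C. cross A B G = {}})"
  define \<epsilon> where "\<epsilon> = fact n * (3 / (4 * real n)) ^ n"
  have \<epsilon>: "0 \<le> \<epsilon>" by (simp add: \<epsilon>_def)
  have finD: "finite D"
    by (rule finite_subset[of _ "Pow V \<times> Pow V"]) (auto simp: D_def V)
  have D': "D' \<subseteq> D" by (auto simp: D'_def)
  have finD': "finite D'" using D' finD by (rule finite_subset)
  have finC: "finite ?C" using V by (simp add: finite_conn_reg)
  have finH: "finite (H P)" for P using finC by (cases P) (auto simp: H_def)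
  have "{G \<in> ?C. p_good 3 G} \<subseteq> (\<Union>P\<in>D'. H P)"
  proof clarify
    fix W E assume G: "(W, E) \<in> ?C" "p_good 3 (W, E)"
    then have "W = V" by (simp add: conn_reg_def)
    then obtain A B where "A \<subseteq> V" "B \<subseteq> V" "A \<inter> B = {}" "cross A B (W, E) = {}"
      "n \<le> 5 * card A" "99 * n \<le> 1000 * card B"
      using good_imp_hole[OF G(2), of n] V n by auto
    then have "(A, B) \<in> D'" "(W, E) \<in> H (A, B)" using G by (auto simp: D'_def D_def H_def)
    then show "(W, E) \<in> (\<Union>P\<in>D'. H P)" by blast
  qed
  then have "card {G \<in> ?C. p_good 3 G} \<le> card (\<Union>P\<in>D'. H P)"
    using finH finD' by (intro card_mono) auto
  also have "\<dots> \<le> (\<Sum>P\<in>D'. card (H P))" by (rule card_UN_le[OF finD'])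
  finally have "real (card {G \<in> ?C. p_good 3 G}) \<le> (\<Sum>P\<in>D'. real (card (H P)))"
    by (simp flip: of_nat_sum)
  also have "\<dots> \<le> (\<Sum>P\<in>D'. card ?C * \<epsilon>)"
    by (rule sum_mono) (auto simp: D'_def D_def H_def \<epsilon>_def intro!: hole_proportion[OF V n])
  also have "\<dots> = card D' * (card ?C * \<epsilon>)" by simp
  also have "\<dots> \<le> 3 ^ n * (card ?C * \<epsilon>)"
  proof (rule mult_right_mono)
    have "card D' \<le> 3 ^ n"
      using card_mono[OF finD D'] card_disjoint_pairs[OF V(1)] V(2) by (simp add: D_def)
    then show "real (card D') \<le> 3 ^ n" by (metis of_nat_le_iff of_nat_numeral of_nat_power)
  qed (use \<epsilon> in simp)
  finally have "real (card {G \<in> ?C. p_good 3 G}) \<le> 3 ^ n * \<epsilon> * card ?C" by (simp add: mult_ac)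
  then show ?thesis
    using \<epsilon> unfolding \<epsilon>_def[symmetric] by (cases "card ?C = 0") (simp_all add: divide_le_eq)
qed

theorem theorem5p1:
  shows "(\<lambda>n. real (card {G :: nat graph. verts G = {1..n} \<and> connected_graph G \<and>
                                         regular_graph 100 G \<and> p_good 3 G})
            / real (card {G :: nat graph. verts G = {1..n} \<and> connected_graph G \<and>
                                         regular_graph 100 G}))
         \<longlonglongrightarrow> 0"
proof (rule tendsto_sandwich[OF _ _ tendsto_const factorial_decay])
  have "{G :: nat graph. verts G = {1..n} \<and> connected_graph G \<and> regular_graph 100 G \<and> p_good 3 G} =
      {G \<in> conn_reg {1..n} 100. p_good 3 G}"
    "{G :: nat graph. verts G = {1..n} \<and> connected_graph G \<and> regular_graph 100 G} = conn_reg {1..n} 100"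
    for n by (auto simp: conn_reg_def)
  then show "eventually (\<lambda>n. real (card {G :: nat graph. verts G = {1..n} \<and> connected_graph G \<and>
                                         regular_graph 100 G \<and> p_good 3 G})
            / real (card {G :: nat graph. verts G = {1..n} \<and> connected_graph G \<and>
                                         regular_graph 100 G})
        \<le> 3 ^ n * (fact n * (3 / (4 * real n)) ^ n)) sequentially"
    by (intro eventually_sequentiallyI[of 200000]) (simp only:, rule good_proportion, auto)
qed simp

end
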